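(* Let $X$ be a finite connected rack with finite enveloping group $\overline{G_X}$. If $Z(\overline{G_X})=\{1\}$, then the number of irreducible strong complex representations of $X$ (up to equivalence) is equal to the number of irreducible complex representations of the group $\overline{G_X}$ (up to equivalence).
   Context: A rack is a set $X$ with a binary operation $\vartriangleright$ such that for every $x\in X$ the map $L_x:X\to X$, $L_x(y)=x\vartriangleright y$, is bijective, and $x\vartriangleright(y\vartriangleright z)=(x\vartriangleright y)\vartriangleright(x\vartriangleright z)$ for all $x,y,z\in X$. A rack homomorphism is a map preserving $\vartriangleright$. For a group $G$, $Conj(G)$ is the rack on the set $G$ with $g\vartriangleright h=ghg^{-1}$. $Inn(X)$ is the group of permutations of $X$ generated by all $L_x$, $x\in X$. The rack $X$ (assumed nonempty) is connected if $Inn(X)$ acts transitively on $X$. The associated group is $As(X)=\langle g_x,\ x\in X\mid g_{x\vartriangleright y}=g_xg_yg_x^{-1},\ x,y\in X\rangle$. For a finite connected rack all permutations $L_x$ have the same order, denoted $n$; moreover in $As(X)$ the element $g_x^n$ is central and $g_x^n=g_y^n$ for all $x,y\in X$. Fixing $x_0\in X$, the finite enveloping group is the quotient $\overline{G_X}=As(X)/\langle g_{x_0}^n\rangle$; it is a finite group. A representation of a rack $X$ on a vector space $V$ is a rack homomorphism $\rho:X\to Conj(GL(V))$, $x\mapsto\rho_x$; it is complex if $V$ is a complex vector space. It is irreducible if the only subspaces $W\subseteq V$ with $\rho_x(W)\subseteq W$ for all $x\in X$ are $\{0\}$ and $V$ (with $V\neq0$ as usual). A stabilizing family of $X$ is a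 finite family (sequence, repetitions allowed) $u_1,\dots,u_k$ of elements of $X$ with $L_{u_k}\cdots L_{u_1}=\mathrm{id}$. The representation $\rho$ is strong if $\rho_{u_k}\cdots\rho_{u_1}=\mathrm{id}$ for every stabilizing family. Two representations $(V,\rho)$, $(V',\phi)$ of $X$ are equivalent if there is a linear isomorphism $T:V\to V'$ with $\phi_xT=T\rho_x$ for all $x\in X$. *)

theory Defs
  imports
    "Jordan_Normal_Form.VS_Connect"
    "HOL-Algebra.Bij"
    "HOL-Algebra.Generated_Groups"
    "HOL-Algebra.Multiplicative_Group"
    "HOL-Library.Equipollence"
begin

section \<open>Racks\<close>

record 'a rack = "'a partial_object" +
  rack_op :: "'a \<Rightarrow> 'a \<Rightarrow> 'a" (infixl \<open>\<triangleright>\<index>\<close> 70)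

locale rack =
  fixes X (structure)
  assumes bij_left: "x \<in> carrier X \<Longrightarrow> bij_betw (\<lambda>y. x \<triangleright> y) (carrier X) (carrier X)"
    and self_distrib:
      "\<lbrakk>x \<in> carrier X; y \<in> carrier X; z \<in> carrier X\<rbrakk>
        \<Longrightarrow> x \<triangleright> (y \<triangleright> z) = (x \<triangleright> y) \<triangleright> (x \<triangleright> z)"

definition rack_hom :: "('a, 'm) rack_scheme \<Rightarrow> ('b, 'n) rack_scheme \<Rightarrow> ('a \<Rightarrow> 'b) set" where
  "rack_hom X Y = {f \<in> carrier X \<rightarrow> carrier Y.
     \<forall>x\<in>carrier X. \<forall>y\<in>carrier X. f (x \<triangleright>\<^bsub>X\<^esub> y) = f x \<triangleright>\<^bsub>Y\<^esub> f y}"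

definition Conj :: "('a, 'm) monoid_scheme \<Rightarrow> 'a rack" where
  "Conj G = \<lparr>carrier = carrier G, rack_op = (\<lambda>g h. g \<otimes>\<^bsub>G\<^esub> h \<otimes>\<^bsub>G\<^esub> inv\<^bsub>G\<^esub> g)\<rparr>"

lemma rack_Conj: assumes "group G" shows "rack (Conj G)"
proof -
  interpret group G by fact
  show ?thesis
  proof
    fix x assume x: "x \<in> carrier (Conj G)"
    then have x: "x \<in> carrier G" by (simp add: Conj_def)
    show "bij_betw (rack_op (Conj G) x) (carrier (Conj G)) (carrier (Conj G))"
      unfolding Conj_def rack.simps partial_object.simps
      by (rule bij_betw_byWitness[where f' = "\<lambda>h. inv\<^bsub>G\<^esub> x \<otimes>\<^bsub>G\<^esub> h \<otimes>\<^bsub>G\<^esub> x"])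
        (use x in \<open>auto simp: m_assoc inv_solve_left\<close>, simp_all add: m_assoc[symmetric])
  qed (auto simp: Conj_def m_assoc inv_mult_group, simp add: m_assoc[symmetric])
qed

text \<open>Permutations of the underlying set are elements of \<^const>\<open>BijGroup\<close>, hence extensional
  functions.\<close>

definition left_mult :: "('a, 'm) rack_scheme \<Rightarrow> 'a \<Rightarrow> 'a \<Rightarrow> 'a" where
  "left_mult X x = (\<lambda>y\<in>carrier X. x \<triangleright>\<^bsub>X\<^esub> y)"

definition Inn :: "('a, 'm) rack_scheme \<Rightarrow> ('a \<Rightarrow> 'a) set" where
  "Inn X = generate (BijGroup (carrier X)) (left_mult X ` carrier X)"

definition connected_rack :: "('a, 'm) rack_scheme \<Rightarrow> bool" where
  "connected_rack X \<longleftrightarrow> carrier X \<noteq> {} \<and>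
     (\<forall>x\<in>carrier X. \<forall>y\<in>carrier X. \<exists>f\<in>Inn X. f x = y)"

section \<open>Group presentations and enveloping groups\<close>

text \<open>A word is a list of letters \<open>(x, b)\<close>, where \<open>(x, True)\<close> stands for the generator \<open>x\<close> and
  \<open>(x, False)\<close> for its formal inverse.  The group presented by generators \<open>S\<close> and relations
  \<open>R\<close> consists of the words over \<open>S\<close> modulo the least congruence containing \<open>R\<close> and the
  cancellation of mutually inverse letters.\<close>

inductive_set word_cong ::
    "'a set \<Rightarrow> (('a \<times> bool) list \<times> ('a \<times> bool) list) set
      \<Rightarrow> (('a \<times> bool) list \<times> ('a \<times> bool) list) set"
  for S :: "'a set" and R :: "(('a \<times> bool) list \<times> ('a \<times> bool) list) set" where
    refl: "w \<in> lists (S \<times> UNIV) \<Longrightarrow> (w, w) \<in> word_cong S R"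
  | sym: "(u, v) \<in> word_cong S R \<Longrightarrow> (v, u) \<in> word_cong S R"
  | trans: "\<lbrakk>(u, v) \<in> word_cong S R; (v, w) \<in> word_cong S R\<rbrakk> \<Longrightarrow> (u, w) \<in> word_cong S R"
  | append: "\<lbrakk>(u, u') \<in> word_cong S R; (v, v') \<in> word_cong S R\<rbrakk>
      \<Longrightarrow> (u @ v, u' @ v') \<in> word_cong S R"
  | cancel: "x \<in> S \<Longrightarrow> ([(x, b), (x, \<not> b)], []) \<in> word_cong S R"
  | relation: "\<lbrakk>(u, v) \<in> R; u \<in> lists (S \<times> UNIV); v \<in> lists (S \<times> UNIV)\<rbrakk>
      \<Longrightarrow> (u, v) \<in> word_cong S R"

definition presented_group ::
    "'a set \<Rightarrow> (('a \<times> bool) list \<times> ('a \<times> bool) list) set \<Rightarrow> ('a \<times> bool) list set monoid" where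
  "presented_group S R =
     \<lparr>carrier = lists (S \<times> UNIV) // word_cong S R,
      mult = (\<lambda>A B. \<Union>a\<in>A. \<Union>b\<in>B. word_cong S R `` {a @ b}),
      one = word_cong S R `` {[]}\<rparr>"

lemma word_cong_lists:
  assumes "(u, v) \<in> word_cong S R"
  shows "u \<in> lists (S \<times> UNIV) \<and> v \<in> lists (S \<times> UNIV)"
  using assms by induction auto

lemma equiv_word_cong: "equiv (lists (S \<times> UNIV)) (word_cong S R)"
  by (rule equivI)
    (auto simp: refl_on_def dest: word_cong_lists
      intro!: symI transI intro: word_cong.refl word_cong.sym word_cong.trans)

lemma word_cong_class_eq:
  "(u, v) \<in> word_cong S R \<Longrightarrow> word_cong S R `` {u} = word_cong S R `` {v}"
  using equiv_class_eq[OF equiv_word_cong] .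

lemma presented_group_mult:
  assumes "u \<in> lists (S \<times> UNIV)" "v \<in> lists (S \<times> UNIV)"
  shows "word_cong S R `` {u} \<otimes>\<^bsub>presented_group S R\<^esub> word_cong S R `` {v}
    = word_cong S R `` {u @ v}"
  unfolding presented_group_def monoid.simps
  by (rule UN_equiv_class2[OF equiv_word_cong equiv_word_cong _ assms])
    (auto intro!: congruent2I' word_cong_class_eq word_cong.append)

lemma word_cong_inverse:
  "w \<in> lists (S \<times> UNIV) \<Longrightarrow> (map (\<lambda>(x, b). (x, \<not> b)) (rev w) @ w, []) \<in> word_cong S R"
proof (induction w)
  case Nil
  then show ?case by (auto intro: word_cong.refl)
next
  case (Cons l w)
  obtain x b where l: "l = (x, b)" by force
  let ?w' = "map (\<lambda>(x, b). (x, \<not> b)) (rev w)"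
  have w: "w \<in> lists (S \<times> UNIV)" and x: "x \<in> S" using Cons.prems l by auto
  have w': "?w' \<in> lists (S \<times> UNIV)" using w by auto
  have c: "([(x, \<not> b), (x, b)], []) \<in> word_cong S R"
    using word_cong.cancel[OF x, of "\<not> b"] by simp
  have "(?w' @ ([(x, \<not> b), (x, b)] @ w), ?w' @ ([] @ w)) \<in> word_cong S R"
    by (intro word_cong.append c word_cong.refl w w')
  then show ?case using Cons.IH[OF w] l by (auto intro: word_cong.trans)
qed

lemma group_presented_group: "group (presented_group S R)"
proof (rule groupI)
  let ?G = "presented_group S R"
  have car: "carrier ?G = lists (S \<times> UNIV) // word_cong S R"
    and one: "\<one>\<^bsub>?G\<^esub> = word_cong S R `` {[]}"
    by (simp_all add: presented_group_def)
  note [simp] = presented_group_mult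
  show "\<one>\<^bsub>?G\<^esub> \<in> carrier ?G" unfolding car one by (rule quotientI) simp
  fix A assume A: "A \<in> carrier ?G"
  then obtain u where u: "A = word_cong S R `` {u}" "u \<in> lists (S \<times> UNIV)"
    unfolding car by (rule quotientE)
  show "\<one>\<^bsub>?G\<^esub> \<otimes>\<^bsub>?G\<^esub> A = A" using u unfolding one by simp
  let ?u = "map (\<lambda>(x, b). (x, \<not> b)) (rev u)"
  have u': "?u \<in> lists (S \<times> UNIV)" using u by auto
  show "\<exists>B\<in>carrier ?G. B \<otimes>\<^bsub>?G\<^esub> A = \<one>\<^bsub>?G\<^esub>"
    by (rule bexI[of _ "word_cong S R `` {?u}"])
      (use u u' word_cong_class_eq[OF word_cong_inverse[OF u(2)]] in
        \<open>simp_all add: car one quotientI\<close>)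
  fix B assume B: "B \<in> carrier ?G"
  then obtain v where v: "B = word_cong S R `` {v}" "v \<in> lists (S \<times> UNIV)"
    unfolding car by (rule quotientE)
  show "A \<otimes>\<^bsub>?G\<^esub> B \<in> carrier ?G" using u v unfolding car by (simp add: quotientI)
  fix C assume C: "C \<in> carrier ?G"
  then obtain w where w: "C = word_cong S R `` {w}" "w \<in> lists (S \<times> UNIV)"
    unfolding car by (rule quotientE)
  show "A \<otimes>\<^bsub>?G\<^esub> B \<otimes>\<^bsub>?G\<^esub> C = A \<otimes>\<^bsub>?G\<^esub> (B \<otimes>\<^bsub>?G\<^esub> C)" using u v w by simp
qed

definition As_rels ::
    "('a, 'm) rack_scheme \<Rightarrow> (('a \<times> bool) list \<times> ('a \<times> bool) list) set" where
  "As_rels X = {([(x \<triangleright>\<^bsub>X\<^esub> y, True)], [(x, True), (y, True), (x, False)]) | x y.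
     x \<in> carrier X \<and> y \<in> carrier X}"

definition As :: "('a, 'm) rack_scheme \<Rightarrow> ('a \<times> bool) list set monoid" where
  "As X = presented_group (carrier X) (As_rels X)"

definition As_gen :: "('a, 'm) rack_scheme \<Rightarrow> 'a \<Rightarrow> ('a \<times> bool) list set" where
  "As_gen X x = word_cong (carrier X) (As_rels X) `` {[(x, True)]}"

text \<open>In a finite connected rack the order of \<^term>\<open>left_mult X x\<close> does not depend on \<open>x\<close>, and
  the \<open>n\<close>-th powers of the generators are central, so the quotient below is one by a normal
  subgroup and does not depend on \<open>x0\<close>.\<close>

definition finite_enveloping_group ::
    "('a, 'm) rack_scheme \<Rightarrow> 'a \<Rightarrow> ('a \<times> bool) list set set monoid" where
  "finite_enveloping_group X x0 =
     (let n = group.ord (BijGroup (carrier X)) (left_mult X x0)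
      in As X Mod generate (As X) {As_gen X x0 [^]\<^bsub>As X\<^esub> n})"

definition group_center :: "('a, 'm) monoid_scheme \<Rightarrow> 'a set" where
  "group_center G = {z \<in> carrier G. \<forall>g\<in>carrier G. z \<otimes>\<^bsub>G\<^esub> g = g \<otimes>\<^bsub>G\<^esub> z}"

section \<open>Complex representations\<close>

text \<open>A complex vector space is a \<^locale>\<open>vectorspace\<close> over \<^term>\<open>class_ring :: complex ring\<close>;
  its carrier may be any subset of the type \<open>'v\<close> and its operations are arbitrary, so that vector
  spaces of different dimensions live in the same type.\<close>

definition GL :: "(complex, 'v) module \<Rightarrow> ('v \<Rightarrow> 'v) monoid" where
  "GL V = BijGroup (carrier V)
     \<lparr>carrier := {f \<in> Bij (carrier V). linear_map class_ring V V f}\<rparr>"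

lemma mult_BijGroup: "f \<in> Bij S \<Longrightarrow> g \<in> Bij S \<Longrightarrow> mult (BijGroup S) f g = compose S f g"
  by (simp add: BijGroup_def)

lemma subgroup_GL:
  assumes "vectorspace class_ring V"
  shows "subgroup {f \<in> Bij (carrier V). linear_map class_ring V V f} (BijGroup (carrier V))"
proof -
  interpret V: vectorspace class_ring V by fact
  have lm: "linear_map class_ring V V f \<longleftrightarrow> f \<in> LinearCombinations.module_hom class_ring V V" for f
    by (auto simp: linear_map_def mod_hom_def mod_hom_axioms_def assms V.module_axioms)
  show ?thesis
    unfolding lm
  proof (rule group.subgroupI[OF group_BijGroup])
    show "{f \<in> Bij (carrier V). f \<in> LinearCombinations.module_hom class_ring V V} \<noteq> {}"
      using id_Bij[of "carrier V"] by (auto simp: LinearCombinations.module_hom_def intro!: exI[of _ "\<lambda>x\<in>carrier V. x"])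
  next
    fix f assume f: "f \<in> {f \<in> Bij (carrier V). f \<in> LinearCombinations.module_hom class_ring V V}"
    then have b: "bij_betw f (carrier V) (carrier V)" "f \<in> Bij (carrier V)" by (auto simp: Bij_def)
    have I: "inv\<^bsub>BijGroup (carrier V)\<^esub> f = (\<lambda>x\<in>carrier V. (inv_into (carrier V) f) x)"
      using b inv_BijGroup by blast
    let ?g = "inv_into (carrier V) f"
    have g: "?g x \<in> carrier V" "f (?g x) = x" if "x \<in> carrier V" for x
      using that b by (auto simp: bij_betw_def inv_into_into f_inv_into_f)
    have gf: "?g (f x) = x" if "x \<in> carrier V" for x using that b by (auto simp: bij_betw_def)
    have "?g (x \<oplus>\<^bsub>V\<^esub> y) = ?g x \<oplus>\<^bsub>V\<^esub> ?g y" if "x \<in> carrier V" "y \<in> carrier V" for x y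
      using gf[of "?g x \<oplus>\<^bsub>V\<^esub> ?g y"] g that f by (auto simp: LinearCombinations.module_hom_def)
    moreover have "?g (c \<odot>\<^bsub>V\<^esub> x) = c \<odot>\<^bsub>V\<^esub> ?g x" if "x \<in> carrier V" for x c
      using gf[of "c \<odot>\<^bsub>V\<^esub> ?g x"] g that f by (auto simp: LinearCombinations.module_hom_def)
    ultimately show "inv\<^bsub>BijGroup (carrier V)\<^esub> f \<in> {f \<in> Bij (carrier V). f \<in> LinearCombinations.module_hom class_ring V V}"
      unfolding I using restrict_inv_into_Bij[OF b(2)] g by (auto simp: LinearCombinations.module_hom_def)
  next
    fix f g assume f: "f \<in> {f \<in> Bij (carrier V). f \<in> LinearCombinations.module_hom class_ring V V}"
      "g \<in> {f \<in> Bij (carrier V). f \<in> LinearCombinations.module_hom class_ring V V}"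
    then show "f \<otimes>\<^bsub>BijGroup (carrier V)\<^esub> g \<in> {f \<in> Bij (carrier V). f \<in> LinearCombinations.module_hom class_ring V V}"
      using compose_Bij[of f "carrier V" g]
      by (auto simp: mult_BijGroup LinearCombinations.module_hom_def compose_def Pi_def)
  qed (auto simp: BijGroup_def)
qed

lemma group_GL: "vectorspace class_ring V \<Longrightarrow> group (GL V)"
  using subgroup.subgroup_is_group[OF subgroup_GL group_BijGroup] by (simp add: GL_def)

text \<open>A pair \<open>(V, \<rho>)\<close> is a vector space with a family of endomorphisms indexed by the elements of a
  rack or of a group.\<close>

type_synonym ('i, 'v) rep = "(complex, 'v) module \<times> ('i \<Rightarrow> 'v \<Rightarrow> 'v)"

definition irreducible_rep :: "'i set \<Rightarrow> ('i, 'v) rep \<Rightarrow> bool" where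
  "irreducible_rep I = (\<lambda>(V, \<rho>). carrier V \<noteq> {\<zero>\<^bsub>V\<^esub>} \<and>
     (\<forall>W. VectorSpace.subspace class_ring W V \<and> (\<forall>i\<in>I. \<rho> i ` W \<subseteq> W)
        \<longrightarrow> W = {\<zero>\<^bsub>V\<^esub>} \<or> W = carrier V))"

definition equivalent_reps :: "'i set \<Rightarrow> ('i, 'v) rep \<Rightarrow> ('i, 'v) rep \<Rightarrow> bool" where
  "equivalent_reps I = (\<lambda>(V, \<rho>) (V', \<phi>). \<exists>T. linear_map class_ring V V' T \<and>
     bij_betw T (carrier V) (carrier V') \<and>
     (\<forall>i\<in>I. \<forall>v\<in>carrier V. \<phi> i (T v) = T (\<rho> i v)))"

text \<open>The set of equivalence classes of a collection \<open>\<R>\<close> of representations.  If \<open>'v\<close> has at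
  least the cardinality of the continuum, then every complex vector space of countable dimension,
  hence every irreducible representation considered here, has an isomorphic copy in \<open>'v\<close>.\<close>

definition up_to_equivalence :: "'i set \<Rightarrow> ('i, 'v) rep set \<Rightarrow> ('i, 'v) rep set set" where
  "up_to_equivalence I \<R> = \<R> // {(p, q). p \<in> \<R> \<and> q \<in> \<R> \<and> equivalent_reps I p q}"

definition rack_rep :: "('a, 'm) rack_scheme \<Rightarrow> ('a, 'v) rep \<Rightarrow> bool" where
  "rack_rep X = (\<lambda>(V, \<rho>). vectorspace class_ring V \<and> \<rho> \<in> rack_hom X (Conj (GL V)))"

text \<open>\<open>family_prod G f [u\<^sub>1, \<dots>, u\<^sub>k]\<close> is the product \<open>f u\<^sub>k \<cdots> f u\<^sub>1\<close> in \<open>G\<close>.\<close>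

definition family_prod :: "('g, 'm) monoid_scheme \<Rightarrow> ('a \<Rightarrow> 'g) \<Rightarrow> 'a list \<Rightarrow> 'g" where
  "family_prod G f us = foldl (\<lambda>g u. f u \<otimes>\<^bsub>G\<^esub> g) \<one>\<^bsub>G\<^esub> us"

definition stabilizing_family :: "('a, 'm) rack_scheme \<Rightarrow> 'a list \<Rightarrow> bool" where
  "stabilizing_family X us \<longleftrightarrow> set us \<subseteq> carrier X \<and>
     family_prod (BijGroup (carrier X)) (left_mult X) us = \<one>\<^bsub>BijGroup (carrier X)\<^esub>"

definition strong_rep :: "('a, 'm) rack_scheme \<Rightarrow> ('a, 'v) rep \<Rightarrow> bool" where
  "strong_rep X = (\<lambda>(V, \<rho>). rack_rep X (V, \<rho>) \<and>
     (\<forall>us. stabilizing_family X us \<longrightarrow> family_prod (GL V) \<rho> us = \<one>\<^bsub>GL V\<^esub>))"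

definition irreducible_strong_reps :: "('a, 'm) rack_scheme \<Rightarrow> ('a, 'v) rep set" where
  "irreducible_strong_reps X = {p. strong_rep X p \<and> irreducible_rep (carrier X) p}"

definition group_rep :: "('g, 'm) monoid_scheme \<Rightarrow> ('g, 'v) rep \<Rightarrow> bool" where
  "group_rep G = (\<lambda>(V, \<rho>). vectorspace class_ring V \<and> \<rho> \<in> hom G (GL V))"

definition irreducible_group_reps :: "('g, 'm) monoid_scheme \<Rightarrow> ('g, 'v) rep set" where
  "irreducible_group_reps G = {p. group_rep G p \<and> irreducible_rep (carrier G) p}"

end

theory Submission
  imports Defs
begin

text \<open>Restricting representations along \<open>x \<mapsto> g\<^sub>x\<close> identifies the representations of the finite enveloping
  group with the strong representations of the rack, for two reasons.

  The first reason concerns products of generators.  For a family \<open>u\<close> of elements write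
  \<open>L(u)\<close> for the composite of the left multiplications by its members and \<open>g(u)\<close> for the
  corresponding product of generators.  Iterating the defining relation shows
  that conjugation by \<open>g(u)\<close> sends \<open>g\<^sub>y\<close> to the generator of \<open>L(u) y\<close> (\<open>As_gen_family_prod\<close>), so
  \<open>L(u) = id\<close> forces \<open>g(u)\<close> to commute with all generators, hence to be central
  (\<open>stabilizing_family_central\<close>).  If the enveloping group has trivial center, \<open>g(u)\<close> dies there, and
  the restriction of every group representation is strong (\<open>strong_pullback\<close>).

  The second reason is that the constant family \<open>x\<^sub>0, \<dots>, x\<^sub>0\<close> of length \<open>n\<close>, the order of the left
  multiplication by \<open>x\<^sub>0\<close>, is itself stabilizing.  On the one hand this makes the \<open>n\<close>-th power of the
  generator at \<open>x\<^sub>0\<close> central, so that the enveloping group is indeed the quotient by a normal subgroup.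
  On the other hand a strong representation must be trivial on it.  Since a rack representation is a map
  satisfying the relations of the associated group, a strong one extends to the enveloping group
  (\<open>strong_rep_extends\<close>).

  It remains to see that restriction neither creates invariant subspaces nor identifies inequivalent
  representations.  By connectedness all generators are conjugate, so each has \<open>n\<close>-th power \<open>1\<close> in the
  enveloping group, and its inverse is its \<open>(n - 1)\<close>-st power.  Therefore every element is a product of
  generators without inverses (\<open>env_induct\<close>), and a subspace that is invariant under the generators, or
  a map that intertwines them, is so for the whole group.\<close>

section \<open>Families and presented groups\<close>

lemma family_prod_Nil: "family_prod G f [] = \<one>\<^bsub>G\<^esub>"
  by (simp add: family_prod_def)

lemma family_prod_snoc: "family_prod G f (us @ [u]) = f u \<otimes>\<^bsub>G\<^esub> family_prod G f us"
  by (simp add: family_prod_def)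

lemma (in monoid) family_prod_closed:
  "f ` set us \<subseteq> carrier G \<Longrightarrow> family_prod G f us \<in> carrier G"
  by (induction us rule: rev_induct) (auto simp: family_prod_Nil family_prod_snoc)

lemma (in group_hom) hom_family_prod:
  "f ` set us \<subseteq> carrier G \<Longrightarrow> h (family_prod G f us) = family_prod H (\<lambda>u. h (f u)) us"
  by (induction us rule: rev_induct)
    (auto simp: family_prod_Nil family_prod_snoc G.family_prod_closed)

lemma (in group) family_prod_replicate:
  assumes "f x \<in> carrier G"
  shows "family_prod G f (replicate k x) = f x [^] k"
proof (induction k)
  case (Suc k)
  have "replicate (Suc k) x = replicate k x @ [x]" by (simp add: replicate_append_same)
  then show ?case
    using Suc nat_pow_Suc2[OF assms] by (simp only: family_prod_snoc)
qed (simp add: family_prod_Nil)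

lemma (in group) inv_mult_cancel:
  "\<lbrakk>x \<in> carrier G; y \<in> carrier G\<rbrakk> \<Longrightarrow> inv x \<otimes> (x \<otimes> y) = y"
  by (simp flip: m_assoc)

lemma (in group) conjugate_pow:
  assumes "x \<in> carrier G" "y \<in> carrier G"
  shows "(x \<otimes> y \<otimes> inv x) [^] (k::nat) = x \<otimes> y [^] k \<otimes> inv x"
  using assms by (induction k) (simp_all add: m_assoc inv_mult_cancel)

lemma BijGroup_one_apply: "y \<in> S \<Longrightarrow> \<one>\<^bsub>BijGroup S\<^esub> y = y"
  by (simp add: BijGroup_def)

lemma BijGroup_mult_apply:
  assumes "f \<in> carrier (BijGroup S)" "g \<in> carrier (BijGroup S)" "y \<in> S"
  shows "(f \<otimes>\<^bsub>BijGroup S\<^esub> g) y = f (g y)"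
  using assms by (simp add: BijGroup_def compose_def)

lemma BijGroup_apply_closed: "\<lbrakk>f \<in> carrier (BijGroup S); y \<in> S\<rbrakk> \<Longrightarrow> f y \<in> S"
  using Bij_imp_funcset by (fastforce simp: BijGroup_def)

lemma presented_group_cases:
  assumes "w \<in> carrier (presented_group S R)"
  obtains u where "w = word_cong S R `` {u}" "u \<in> lists (S \<times> UNIV)"
proof -
  have "w \<in> lists (S \<times> UNIV) // word_cong S R"
    using assms by (simp add: presented_group_def)
  then show thesis using that by (rule quotientE)
qed

lemma presented_group_gen_closed:
  "x \<in> S \<Longrightarrow> word_cong S R `` {[(x, b)]} \<in> carrier (presented_group S R)"
  by (auto simp: presented_group_def intro: quotientI)

lemma presented_group_inv_gen:
  assumes "x \<in> S"
  shows "inv\<^bsub>presented_group S R\<^esub> (word_cong S R `` {[(x, True)]}) = word_cong S R `` {[(x, False)]}"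
proof (rule group.inv_equality[OF group_presented_group])
  show "word_cong S R `` {[(x, False)]} \<otimes>\<^bsub>presented_group S R\<^esub> word_cong S R `` {[(x, True)]}
    = \<one>\<^bsub>presented_group S R\<^esub>"
    using assms word_cong_class_eq[OF word_cong.cancel[OF assms, of False R]]
    by (simp add: presented_group_mult) (simp add: presented_group_def)
qed (use assms in \<open>auto intro: presented_group_gen_closed\<close>)

text \<open>Words are read one letter at a time, which avoids choosing representatives in later arguments about
  the associated group.\<close>

lemma presented_group_induct [consumes 1, case_names one gen inv_gen]:
  assumes w: "w \<in> carrier (presented_group S R)"
    and one: "P \<one>\<^bsub>presented_group S R\<^esub>"
    and gen: "\<And>x v. \<lbrakk>x \<in> S; v \<in> carrier (presented_group S R); P v\<rbrakk>
      \<Longrightarrow> P (word_cong S R `` {[(x, True)]} \<otimes>\<^bsub>presented_group S R\<^esub> v)"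
    and inv_gen: "\<And>x v. \<lbrakk>x \<in> S; v \<in> carrier (presented_group S R); P v\<rbrakk>
      \<Longrightarrow> P (inv\<^bsub>presented_group S R\<^esub> (word_cong S R `` {[(x, True)]}) \<otimes>\<^bsub>presented_group S R\<^esub> v)"
  shows "P w"
proof -
  obtain u where u: "w = word_cong S R `` {u}" "u \<in> lists (S \<times> UNIV)"
    using w by (rule presented_group_cases)
  have "P (word_cong S R `` {u})" using u(2)
  proof (induction u)
    case Nil
    then show ?case using one by (simp add: presented_group_def)
  next
    case (Cons l u)
    obtain x b where l: "l = (x, b)" by force
    have x: "x \<in> S" and u: "u \<in> lists (S \<times> UNIV)" using Cons l by auto
    have v: "word_cong S R `` {u} \<in> carrier (presented_group S R)"
      using u by (simp add: presented_group_def quotientI)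
    have "word_cong S R `` {l # u}
      = word_cong S R `` {[(x, b)]} \<otimes>\<^bsub>presented_group S R\<^esub> word_cong S R `` {u}"
      using x u l by (subst presented_group_mult) auto
    then show ?case
      using gen[OF x v] inv_gen[OF x v] Cons.IH presented_group_inv_gen[OF x, of R]
      by (cases b) auto
  qed
  then show ?thesis using u by simp
qed

definition word_eval :: "('g, 'm) monoid_scheme \<Rightarrow> ('a \<Rightarrow> 'g) \<Rightarrow> ('a \<times> bool) list \<Rightarrow> 'g" where
  "word_eval H f w = foldr (\<lambda>(x, b) h. (if b then f x else inv\<^bsub>H\<^esub> f x) \<otimes>\<^bsub>H\<^esub> h) w \<one>\<^bsub>H\<^esub>"

context group
begin

lemma word_eval_closed:
  "\<lbrakk>f ` S \<subseteq> carrier G; w \<in> lists (S \<times> UNIV)\<rbrakk> \<Longrightarrow> word_eval G f w \<in> carrier G"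
  by (induction w) (auto simp: word_eval_def image_subset_iff)

lemma word_eval_append:
  assumes "f ` S \<subseteq> carrier G" "v \<in> lists (S \<times> UNIV)"
  shows "w \<in> lists (S \<times> UNIV) \<Longrightarrow> word_eval G f (w @ v) = word_eval G f w \<otimes> word_eval G f v"
proof (induction w)
  case Nil
  then show ?case using word_eval_closed[OF assms] by (simp add: word_eval_def)
next
  case (Cons l w)
  obtain x b where l: "l = (x, b)" by force
  have x: "f x \<in> carrier G" and w: "w \<in> lists (S \<times> UNIV)" using Cons assms l by auto
  have "word_eval G f (l # v) = (if b then f x else inv f x) \<otimes> word_eval G f v" for v
    by (simp add: word_eval_def l)
  then show ?case
    using Cons.IH[OF w] x word_eval_closed[OF assms] word_eval_closed[OF assms(1) w]
    by (simp add: m_assoc)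
qed

lemma word_eval_cong:
  assumes f: "f ` S \<subseteq> carrier G"
    and rel: "\<And>u v. \<lbrakk>(u, v) \<in> R; u \<in> lists (S \<times> UNIV); v \<in> lists (S \<times> UNIV)\<rbrakk>
      \<Longrightarrow> word_eval G f u = word_eval G f v"
    and uv: "(u, v) \<in> word_cong S R"
  shows "word_eval G f u = word_eval G f v"
  using uv
proof induction
  case (append u u' v v')
  then show ?case
    using word_cong_lists[OF append.hyps(1)] word_cong_lists[OF append.hyps(2)]
      word_eval_append[OF f] by simp
next
  case (cancel x b)
  then show ?case using f by (auto simp: word_eval_def image_subset_iff)
next
  case (trans u v w)
  show ?case using trans.IH by (rule HOL.trans)
next
  case (relation u v)
  then show ?case by (rule rel)
qed simp_all

text \<open>This is von Dyck's theorem: evaluation of words is constant on congruence classes because it respects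
  each rule generating the congruence.\<close>

lemma presented_group_universal:
  assumes f: "f ` S \<subseteq> carrier G"
    and rel: "\<And>u v. \<lbrakk>(u, v) \<in> R; u \<in> lists (S \<times> UNIV); v \<in> lists (S \<times> UNIV)\<rbrakk>
      \<Longrightarrow> word_eval G f u = word_eval G f v"
  obtains h where "h \<in> hom (presented_group S R) G"
    and "\<And>x. x \<in> S \<Longrightarrow> h (word_cong S R `` {[(x, True)]}) = f x"
proof -
  define h where "h = (\<lambda>A. the_elem (word_eval G f ` A))"
  have h: "h (word_cong S R `` {u}) = word_eval G f u" if "u \<in> lists (S \<times> UNIV)" for u
  proof -
    have "word_eval G f v = word_eval G f u" if "v \<in> word_cong S R `` {u}" for v
      using word_eval_cong[OF f rel] that by fastforce
    moreover have "u \<in> word_cong S R `` {u}" using word_cong.refl[OF that] by simp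
    ultimately have "word_eval G f ` (word_cong S R `` {u}) = {word_eval G f u}" by blast
    then show ?thesis by (simp add: h_def)
  qed
  have "h \<in> hom (presented_group S R) G"
  proof (rule homI)
    fix A assume "A \<in> carrier (presented_group S R)"
    then obtain u where u: "A = word_cong S R `` {u}" "u \<in> lists (S \<times> UNIV)"
      by (rule presented_group_cases)
    then show "h A \<in> carrier G" using h word_eval_closed[OF f] by simp
    fix B assume "B \<in> carrier (presented_group S R)"
    then obtain v where v: "B = word_cong S R `` {v}" "v \<in> lists (S \<times> UNIV)"
      by (rule presented_group_cases)
    show "h (A \<otimes>\<^bsub>presented_group S R\<^esub> B) = h A \<otimes> h B"
      using u v h word_eval_append[OF f v(2) u(2)] by (simp add: presented_group_mult)
  qed
  moreover have "h (word_cong S R `` {[(x, True)]}) = f x" if "x \<in> S" for x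
    using that f h[of "[(x, True)]"] by (auto simp: word_eval_def image_subset_iff)
  ultimately show thesis using that by blast
qed

end

section \<open>Representations and equivalence classes\<close>

lemma (in group) group_rep_apply:
  assumes "group_rep G (V, \<phi>)"
  shows "g \<in> carrier G \<Longrightarrow> v \<in> carrier V \<Longrightarrow> \<phi> g v \<in> carrier V"
    and "v \<in> carrier V \<Longrightarrow> \<phi> \<one> v = v"
    and "\<lbrakk>g \<in> carrier G; h \<in> carrier G; v \<in> carrier V\<rbrakk>
      \<Longrightarrow> \<phi> (g \<otimes> h) v = \<phi> g (\<phi> h v)"
proof -
  have V: "vectorspace class_ring V" and \<phi>: "\<phi> \<in> hom G (GL V)"
    using assms by (auto simp: group_rep_def)
  interpret gh: group_hom G "GL V" \<phi>
    using \<phi> group_GL[OF V] by (simp add: group_hom_def group_hom_axioms_def group_axioms)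
  have B: "\<phi> g \<in> Bij (carrier V)" if "g \<in> carrier G" for g
    using gh.hom_closed[OF that] by (simp add: GL_def)
  show "g \<in> carrier G \<Longrightarrow> v \<in> carrier V \<Longrightarrow> \<phi> g v \<in> carrier V"
    using Bij_imp_funcset[OF B] by blast
  show "v \<in> carrier V \<Longrightarrow> \<phi> \<one> v = v"
    using gh.hom_one by (simp add: GL_def BijGroup_def)
  show "\<lbrakk>g \<in> carrier G; h \<in> carrier G; v \<in> carrier V\<rbrakk>
      \<Longrightarrow> \<phi> (g \<otimes> h) v = \<phi> g (\<phi> h v)"
    using B by (simp add: GL_def mult_BijGroup compose_def)
qed

lemma irreducible_rep_cong:
  "(\<And>i. i \<in> I \<Longrightarrow> \<rho> i = \<rho>' i) \<Longrightarrow> irreducible_rep I (V, \<rho>) \<longleftrightarrow> irreducible_rep I (V, \<rho>')"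
  by (simp add: irreducible_rep_def)

lemma equivalent_reps_cong:
  assumes "\<And>i. i \<in> I \<Longrightarrow> \<rho> i = \<rho>' i"
  shows "equivalent_reps I (V, \<rho>) p \<longleftrightarrow> equivalent_reps I (V, \<rho>') p"
    and "equivalent_reps I p (V, \<rho>) \<longleftrightarrow> equivalent_reps I p (V, \<rho>')"
  using assms by (cases p; simp add: equivalent_reps_def)+

text \<open>The bijection of classes is taken contravariantly, as preimage under \<open>f\<close>: this needs no choice of
  representatives, and its values are classes by the hypothesis on \<open>e\<close> and \<open>e'\<close>.  Surjectivity of \<open>f\<close>
  is only asked for up to indistinguishability by \<open>e\<close>, because a representation of a rack is a function
  whose values outside the rack are arbitrary and which \<open>f\<close> can therefore miss.\<close>

lemma quotient_eqpoll_via: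
  assumes f: "f ` B \<subseteq> A"
    and rel: "\<And>b b'. \<lbrakk>b \<in> B; b' \<in> B\<rbrakk> \<Longrightarrow> e (f b) (f b') \<longleftrightarrow> e' b b'"
    and onto: "\<And>a. a \<in> A \<Longrightarrow> \<exists>b\<in>B. \<forall>c. (e (f b) c \<longleftrightarrow> e a c) \<and> (e c (f b) \<longleftrightarrow> e c a)"
  shows "A // {(p, q). p \<in> A \<and> q \<in> A \<and> e p q} \<approx> B // {(p, q). p \<in> B \<and> q \<in> B \<and> e' p q}"
proof -
  define r where "r = {(p, q). p \<in> A \<and> q \<in> A \<and> e p q}"
  define s where "s = {(p, q). p \<in> B \<and> q \<in> B \<and> e' p q}"
  define pre where "pre C = {b \<in> B. f b \<in> C}" for C
  have pre: "pre (r `` {f b}) = s `` {b}" if "b \<in> B" for b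
    using that f rel by (auto simp: pre_def r_def s_def)
  have class_image: "\<exists>b\<in>B. C = r `` {f b}" if "C \<in> A // r" for C
  proof -
    obtain a where a: "a \<in> A" "C = r `` {a}" using \<open>C \<in> A // r\<close> by (rule quotientE)
    then obtain b where "b \<in> B" "\<forall>c. e (f b) c \<longleftrightarrow> e a c" using onto by blast
    then show ?thesis using a f by (auto simp: r_def)
  qed
  \<comment> \<open>A class is determined by its preimage, since every element of \<open>A\<close> has an indistinguishable twin
    in the range of \<open>f\<close>.\<close>
  have mem_iff: "c \<in> r `` {f b} \<longleftrightarrow> c \<in> A \<and> (\<exists>b'\<in>pre (r `` {f b}). \<forall>d. e d (f b') \<longleftrightarrow> e d c)"
    if "b \<in> B" for b c
    using that f onto[of c] by (auto simp: pre_def r_def)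
  have "bij_betw pre (A // r) (B // s)"
    unfolding bij_betw_def
  proof
    show "inj_on pre (A // r)"
    proof (rule inj_onI)
      fix C D assume C: "C \<in> A // r" and D: "D \<in> A // r" and eq: "pre C = pre D"
      obtain b where b: "b \<in> B" "C = r `` {f b}" using class_image[OF C] by blast
      obtain b' where b': "b' \<in> B" "D = r `` {f b'}" using class_image[OF D] by blast
      show "C = D"
        using mem_iff[OF b(1)] mem_iff[OF b'(1)] eq unfolding b(2) b'(2) by (metis subsetI subset_antisym)
    qed
    show "pre ` (A // r) = B // s"
    proof
      show "pre ` (A // r) \<subseteq> B // s"
        using class_image pre by (force intro: quotientI)
      show "B // s \<subseteq> pre ` (A // r)"
      proof
        fix D assume "D \<in> B // s"
        then obtain b where "b \<in> B" "D = s `` {b}" by (rule quotientE)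
        then show "D \<in> pre ` (A // r)"
          using pre f by (auto intro!: image_eqI[of _ pre "r `` {f b}"] quotientI)
      qed
    qed
  qed
  then show ?thesis unfolding eqpoll_def r_def s_def by blast
qed

section \<open>The associated group of a rack\<close>

context rack
begin

lemma op_closed: "\<lbrakk>x \<in> carrier X; y \<in> carrier X\<rbrakk> \<Longrightarrow> x \<triangleright> y \<in> carrier X"
  using bij_left[of x] by (auto simp: bij_betw_def)

lemma left_mult_apply: "y \<in> carrier X \<Longrightarrow> left_mult X x y = x \<triangleright> y"
  by (simp add: left_mult_def)

lemma left_mult_Bij: "x \<in> carrier X \<Longrightarrow> left_mult X x \<in> carrier (BijGroup (carrier X))"
  using bij_left[of x] by (auto simp: left_mult_def BijGroup_def Bij_def)

sublocale As: group "As X"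
  unfolding As_def by (rule group_presented_group)

lemma As_gen_closed [simp]: "x \<in> carrier X \<Longrightarrow> As_gen X x \<in> carrier (As X)"
  unfolding As_def As_gen_def by (rule presented_group_gen_closed)

lemma As_gen_op:
  assumes "x \<in> carrier X" "y \<in> carrier X"
  shows "As_gen X (x \<triangleright> y) = As_gen X x \<otimes>\<^bsub>As X\<^esub> As_gen X y \<otimes>\<^bsub>As X\<^esub> inv\<^bsub>As X\<^esub> As_gen X x"
proof -
  have "([(x \<triangleright> y, True)], [(x, True), (y, True), (x, False)]) \<in> word_cong (carrier X) (As_rels X)"
    by (rule word_cong.relation) (use assms op_closed in \<open>auto simp: As_rels_def\<close>)
  from word_cong_class_eq[OF this] show ?thesis
    using assms by (simp add: As_def As_gen_def presented_group_inv_gen presented_group_mult)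
qed

lemma As_induct [consumes 1, case_names one gen inv_gen]:
  assumes "w \<in> carrier (As X)" "P \<one>\<^bsub>As X\<^esub>"
    and "\<And>x v. \<lbrakk>x \<in> carrier X; v \<in> carrier (As X); P v\<rbrakk> \<Longrightarrow> P (As_gen X x \<otimes>\<^bsub>As X\<^esub> v)"
    and "\<And>x v. \<lbrakk>x \<in> carrier X; v \<in> carrier (As X); P v\<rbrakk> \<Longrightarrow> P (inv\<^bsub>As X\<^esub> As_gen X x \<otimes>\<^bsub>As X\<^esub> v)"
  shows "P w"
  using assms unfolding As_def As_gen_def by (rule presented_group_induct)

text \<open>The relations of the associated group say exactly that \<open>x \<mapsto> g\<^sub>x\<close> is a rack homomorphism into
  the conjugation rack, so the functor \<open>As\<close> is left adjoint to \<open>Conj\<close>.\<close>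

lemma As_universal:
  assumes "group H" and f: "f \<in> rack_hom X (Conj H)"
  obtains h where "h \<in> hom (As X) H" "\<And>x. x \<in> carrier X \<Longrightarrow> h (As_gen X x) = f x"
proof -
  interpret H: group H by fact
  have fc: "f ` carrier X \<subseteq> carrier H"
    using f by (auto simp: rack_hom_def Conj_def)
  have fop: "f (x \<triangleright> y) = f x \<otimes>\<^bsub>H\<^esub> f y \<otimes>\<^bsub>H\<^esub> inv\<^bsub>H\<^esub> f x"
    if "x \<in> carrier X" "y \<in> carrier X" for x y
    using f that by (auto simp: rack_hom_def Conj_def)
  show thesis
  proof (rule H.presented_group_universal[OF fc, of "As_rels X"])
    fix u v assume "(u, v) \<in> As_rels X"
    then show "word_eval H f u = word_eval H f v"
      using fc fop op_closed
      by (auto simp: As_rels_def word_eval_def image_subset_iff H.m_assoc)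
  qed (use that in \<open>auto simp: As_def As_gen_def\<close>)
qed

lemma family_prod_left_mult_closed:
  "set us \<subseteq> carrier X
    \<Longrightarrow> family_prod (BijGroup (carrier X)) (left_mult X) us \<in> carrier (BijGroup (carrier X))"
  using left_mult_Bij
  by (intro monoid.family_prod_closed group.is_monoid group_BijGroup) auto

text \<open>The associated group acts on the rack through the left multiplications; on generators this action
  is conjugation.\<close>

lemma As_gen_family_prod:
  assumes "set us \<subseteq> carrier X" "y \<in> carrier X"
  shows "As_gen X (family_prod (BijGroup (carrier X)) (left_mult X) us y)
    = family_prod (As X) (As_gen X) us \<otimes>\<^bsub>As X\<^esub> As_gen X y
      \<otimes>\<^bsub>As X\<^esub> inv\<^bsub>As X\<^esub> family_prod (As X) (As_gen X) us"
  using assms(1)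
proof (induction us rule: rev_induct)
  case Nil
  then show ?case using assms(2) by (simp add: family_prod_Nil BijGroup_one_apply)
next
  case (snoc u us)
  let ?L = "family_prod (BijGroup (carrier X)) (left_mult X) us"
  have u: "u \<in> carrier X" and us: "set us \<subseteq> carrier X" using snoc by auto
  have L: "?L y \<in> carrier X"
    using BijGroup_apply_closed[OF family_prod_left_mult_closed[OF us] assms(2)] .
  have w: "family_prod (As X) (As_gen X) us \<in> carrier (As X)"
    using us by (intro As.family_prod_closed) auto
  show ?case
    using u L w assms(2) snoc.IH[OF us]
    by (simp add: family_prod_snoc BijGroup_mult_apply left_mult_Bij
        family_prod_left_mult_closed[OF us] left_mult_apply As_gen_op As.m_assoc As.inv_mult_group)
qed

lemma As_centerI:
  assumes z: "z \<in> carrier (As X)"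
    and comm: "\<And>x. x \<in> carrier X \<Longrightarrow> z \<otimes>\<^bsub>As X\<^esub> As_gen X x = As_gen X x \<otimes>\<^bsub>As X\<^esub> z"
  shows "z \<in> group_center (As X)"
proof -
  have "z \<otimes>\<^bsub>As X\<^esub> w = w \<otimes>\<^bsub>As X\<^esub> z" if "w \<in> carrier (As X)" for w
    using that
  proof (induction rule: As_induct)
    case one
    then show ?case using z by simp
  next
    case (gen x v)
    then show ?case using z comm[of x] by (metis As.m_assoc As_gen_closed)
  next
    case (inv_gen x v)
    have "z \<otimes>\<^bsub>As X\<^esub> inv\<^bsub>As X\<^esub> As_gen X x = inv\<^bsub>As X\<^esub> As_gen X x \<otimes>\<^bsub>As X\<^esub> z"
      using z comm[of x] inv_gen(1)
      by (metis As.inv_solve_left As.inv_solve_right As.m_assoc As.m_closed As.inv_closed As_gen_closed)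
    then show ?case using z inv_gen by (metis As.m_assoc As.inv_closed As_gen_closed)
  qed
  then show ?thesis using z by (simp add: group_center_def)
qed

text \<open>Conjugation by the product of the family fixes every generator, and the generators generate.\<close>

lemma stabilizing_family_central:
  assumes "stabilizing_family X us"
  shows "family_prod (As X) (As_gen X) us \<in> group_center (As X)"
proof (rule As_centerI)
  have us: "set us \<subseteq> carrier X"
    and id: "family_prod (BijGroup (carrier X)) (left_mult X) us = \<one>\<^bsub>BijGroup (carrier X)\<^esub>"
    using assms by (auto simp: stabilizing_family_def)
  show w: "family_prod (As X) (As_gen X) us \<in> carrier (As X)"
    using us by (intro As.family_prod_closed) auto
  fix x assume x: "x \<in> carrier X"
  have "As_gen X x = family_prod (As X) (As_gen X) us \<otimes>\<^bsub>As X\<^esub> As_gen X x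
      \<otimes>\<^bsub>As X\<^esub> inv\<^bsub>As X\<^esub> family_prod (As X) (As_gen X) us"
    using As_gen_family_prod[OF us x] x by (simp add: id BijGroup_one_apply)
  then show "family_prod (As X) (As_gen X) us \<otimes>\<^bsub>As X\<^esub> As_gen X x
      = As_gen X x \<otimes>\<^bsub>As X\<^esub> family_prod (As X) (As_gen X) us"
    using w x by (metis As.inv_solve_right As.m_closed As_gen_closed)
qed

text \<open>Since \<open>f\<close> is a product of left multiplications and their inverses, the conjugating element is the
  corresponding product of generators.  The membership of \<open>f\<close> in the symmetric group is carried along
  because composition there is only meaningful for its elements.\<close>

lemma As_gen_Inn_conjugate:
  assumes "f \<in> Inn X"
  shows "f \<in> carrier (BijGroup (carrier X)) \<and> (\<forall>y\<in>carrier X. \<exists>w\<in>carrier (As X).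
    As_gen X (f y) = w \<otimes>\<^bsub>As X\<^esub> As_gen X y \<otimes>\<^bsub>As X\<^esub> inv\<^bsub>As X\<^esub> w)"
proof -
  interpret B: group "BijGroup (carrier X)" by (rule group_BijGroup)
  show ?thesis
    using assms unfolding Inn_def
  proof induction
    case one
    then show ?case
      by (auto simp: BijGroup_one_apply intro!: bexI[of _ "\<one>\<^bsub>As X\<^esub>"])
  next
    case (incl h)
    then show ?case using left_mult_Bij by (auto simp: left_mult_apply As_gen_op)
  next
    case (inv h)
    then obtain x where x: "x \<in> carrier X" "h = left_mult X x" by auto
    have h: "h \<in> carrier (BijGroup (carrier X))" using x left_mult_Bij by simp
    have "\<exists>w\<in>carrier (As X).
        As_gen X ((inv\<^bsub>BijGroup (carrier X)\<^esub> h) y) = w \<otimes>\<^bsub>As X\<^esub> As_gen X y \<otimes>\<^bsub>As X\<^esub> inv\<^bsub>As X\<^esub> w"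
      if y: "y \<in> carrier X" for y
    proof
      let ?z = "(inv\<^bsub>BijGroup (carrier X)\<^esub> h) y"
      have z: "?z \<in> carrier X" using BijGroup_apply_closed[OF B.inv_closed[OF h] y] .
      have "x \<triangleright> ?z = (h \<otimes>\<^bsub>BijGroup (carrier X)\<^esub> inv\<^bsub>BijGroup (carrier X)\<^esub> h) y"
        using x y z h by (simp only: BijGroup_mult_apply B.inv_closed left_mult_apply)
      also have "\<dots> = y"
        using h y by (simp add: BijGroup_one_apply)
      finally have "As_gen X y = As_gen X x \<otimes>\<^bsub>As X\<^esub> As_gen X ?z \<otimes>\<^bsub>As X\<^esub> inv\<^bsub>As X\<^esub> As_gen X x"
        using As_gen_op[OF x(1) z] by simp
      then show "As_gen X ?z = inv\<^bsub>As X\<^esub> As_gen X x \<otimes>\<^bsub>As X\<^esub> As_gen X y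
          \<otimes>\<^bsub>As X\<^esub> inv\<^bsub>As X\<^esub> (inv\<^bsub>As X\<^esub> As_gen X x)"
        using x z y by (simp add: As.m_assoc As.inv_mult_cancel)
    qed (use x in simp)
    then show ?case using h by simp
  next
    case (eng h1 h2)
    show ?case
    proof (intro conjI ballI)
      show "h1 \<otimes>\<^bsub>BijGroup (carrier X)\<^esub> h2 \<in> carrier (BijGroup (carrier X))"
        using eng.IH by (intro B.m_closed) auto
      fix y assume y: "y \<in> carrier X"
      have h1: "h1 \<in> carrier (BijGroup (carrier X))" and h2: "h2 \<in> carrier (BijGroup (carrier X))"
        using eng.IH by simp_all
      have h2y: "h2 y \<in> carrier X" using BijGroup_apply_closed[OF h2 y] .
      obtain v where v: "v \<in> carrier (As X)"
        "As_gen X (h1 (h2 y)) = v \<otimes>\<^bsub>As X\<^esub> As_gen X (h2 y) \<otimes>\<^bsub>As X\<^esub> inv\<^bsub>As X\<^esub> v"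
        using eng.IH(1) h2y by blast
      obtain w where w: "w \<in> carrier (As X)"
        "As_gen X (h2 y) = w \<otimes>\<^bsub>As X\<^esub> As_gen X y \<otimes>\<^bsub>As X\<^esub> inv\<^bsub>As X\<^esub> w"
        using eng.IH(2) y by blast
      have "As_gen X (h1 (h2 y))
          = v \<otimes>\<^bsub>As X\<^esub> w \<otimes>\<^bsub>As X\<^esub> As_gen X y \<otimes>\<^bsub>As X\<^esub> inv\<^bsub>As X\<^esub> (v \<otimes>\<^bsub>As X\<^esub> w)"
        using y v w by (simp add: As.m_assoc As.inv_mult_group)
      then show "\<exists>w\<in>carrier (As X). As_gen X ((h1 \<otimes>\<^bsub>BijGroup (carrier X)\<^esub> h2) y)
          = w \<otimes>\<^bsub>As X\<^esub> As_gen X y \<otimes>\<^bsub>As X\<^esub> inv\<^bsub>As X\<^esub> w"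
        using v(1) w(1) by (subst BijGroup_mult_apply[OF h1 h2 y]) (rule bexI[of _ "v \<otimes>\<^bsub>As X\<^esub> w"], simp_all)
    qed
  qed
qed

end

section \<open>The finite enveloping group\<close>

locale pointed_finite_connected_rack = rack X for X :: "'x rack" (structure) +
  fixes x0 :: 'x
  assumes finite_carrier: "finite (carrier X)"
    and connected: "connected_rack X"
    and base_point: "x0 \<in> carrier X"
begin

abbreviation "left_order \<equiv> group.ord (BijGroup (carrier X)) (left_mult X x0)"

abbreviation "power_subgroup \<equiv> generate (As X) {As_gen X x0 [^]\<^bsub>As X\<^esub> left_order}"

abbreviation "env \<equiv> finite_enveloping_group X x0"

abbreviation "env_proj \<equiv> (\<lambda>w. power_subgroup #>\<^bsub>As X\<^esub> w)"

definition env_gen :: "'x \<Rightarrow> ('x \<times> bool) list set set" where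
  "env_gen x = env_proj (As_gen X x)"

lemma env_def: "env = As X Mod power_subgroup"
  by (simp add: finite_enveloping_group_def Let_def)

text \<open>Finiteness of the rack enters here.  An element of infinite order has \<open>ord\<close> equal to \<open>0\<close> by
  convention, and positivity is what turns inverses of generators into powers.\<close>

lemma left_order_pos: "left_order > 0"
proof -
  have "carrier (BijGroup (carrier X)) \<subseteq> carrier X \<rightarrow>\<^sub>E carrier X"
    by (auto simp: BijGroup_def Bij_def bij_betw_def PiE_def)
  then have "finite (carrier (BijGroup (carrier X)))"
    using finite_carrier finite_subset by (blast intro: finite_PiE)
  then show ?thesis
    using group.ord_ge_1[OF group_BijGroup _ left_mult_Bij[OF base_point]] by fastforce
qed

lemma stabilizing_family_left_order: "stabilizing_family X (replicate left_order x0)"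
proof -
  interpret B: group "BijGroup (carrier X)" by (rule group_BijGroup)
  show ?thesis
    using base_point left_mult_Bij
    by (auto simp: stabilizing_family_def B.family_prod_replicate)
qed

lemma gen_power_central: "As_gen X x0 [^]\<^bsub>As X\<^esub> left_order \<in> group_center (As X)"
  using stabilizing_family_central[OF stabilizing_family_left_order] base_point
  by (simp add: As.family_prod_replicate)

lemma power_subgroup_normal: "power_subgroup \<lhd> As X"
proof (rule As.normal_generateI)
  fix h g assume h: "h \<in> {As_gen X x0 [^]\<^bsub>As X\<^esub> left_order}" and g: "g \<in> carrier (As X)"
  have hc: "h \<in> carrier (As X)" and "g \<otimes>\<^bsub>As X\<^esub> h = h \<otimes>\<^bsub>As X\<^esub> g"
    using gen_power_central h g by (simp_all add: group_center_def)
  then have "g \<otimes>\<^bsub>As X\<^esub> h \<otimes>\<^bsub>As X\<^esub> inv\<^bsub>As X\<^esub> g = h"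
    using g by (simp add: As.m_assoc)
  then show "g \<otimes>\<^bsub>As X\<^esub> h \<otimes>\<^bsub>As X\<^esub> inv\<^bsub>As X\<^esub> g \<in> {As_gen X x0 [^]\<^bsub>As X\<^esub> left_order}"
    using h by simp
qed (use base_point in auto)

sublocale env: group env
  unfolding env_def by (rule normal.factorgroup_is_group[OF power_subgroup_normal])

sublocale env_proj: group_hom "As X" env env_proj
  using normal.r_coset_hom_Mod[OF power_subgroup_normal]
  by (intro group_hom.intro group_hom_axioms.intro)
    (simp_all add: As.group_axioms env.group_axioms flip: env_def)

lemma env_cases:
  assumes "g \<in> carrier env"
  obtains w where "w \<in> carrier (As X)" "g = env_proj w"
  using assms unfolding env_def carrier_FactGroup by blast

lemma env_gen_closed [simp]: "x \<in> carrier X \<Longrightarrow> env_gen x \<in> carrier env"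
  unfolding env_gen_def by (rule env_proj.hom_closed) simp

lemma env_gen_rack_hom: "env_gen \<in> rack_hom X (Conj env)"
  by (auto simp: rack_hom_def Conj_def env_gen_def As_gen_op)

text \<open>The power is trivial at the base point by construction, and triviality is invariant under
  conjugation; connectedness makes every generator conjugate to the one at the base point.\<close>

lemma env_gen_power:
  assumes x: "x \<in> carrier X"
  shows "env_gen x [^]\<^bsub>env\<^esub> left_order = \<one>\<^bsub>env\<^esub>"
proof -
  interpret N: normal power_subgroup "As X" by (rule power_subgroup_normal)
  obtain f where f: "f \<in> Inn X" "f x0 = x"
    using connected x base_point by (auto simp: connected_rack_def)
  obtain w where w: "w \<in> carrier (As X)"
    and gx: "As_gen X x = w \<otimes>\<^bsub>As X\<^esub> As_gen X x0 \<otimes>\<^bsub>As X\<^esub> inv\<^bsub>As X\<^esub> w"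
    using As_gen_Inn_conjugate[OF f(1)] base_point f(2) by blast
  have x0_power: "env_gen x0 [^]\<^bsub>env\<^esub> left_order = \<one>\<^bsub>env\<^esub>"
  proof -
    have "env_gen x0 [^]\<^bsub>env\<^esub> left_order = env_proj (As_gen X x0 [^]\<^bsub>As X\<^esub> left_order)"
      using base_point by (simp add: env_gen_def env_proj.hom_nat_pow)
    also have "\<dots> = power_subgroup"
    proof (rule As.coset_join2[OF _ N.subgroup_axioms])
      show "As_gen X x0 [^]\<^bsub>As X\<^esub> left_order \<in> power_subgroup" by (rule generate.incl) simp
      show "As_gen X x0 [^]\<^bsub>As X\<^esub> left_order \<in> carrier (As X)" using base_point by simp
    qed
    also have "\<dots> = \<one>\<^bsub>env\<^esub>" by (simp add: env_def FactGroup_def)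
    finally show ?thesis .
  qed
  have v: "env_proj w \<in> carrier env" using w by (rule env_proj.hom_closed)
  have x0: "As_gen X x0 \<in> carrier (As X)" using base_point by simp
  have "env_gen x = env_proj w \<otimes>\<^bsub>env\<^esub> env_gen x0 \<otimes>\<^bsub>env\<^esub> inv\<^bsub>env\<^esub> env_proj w"
    unfolding env_gen_def gx
    by (simp only: env_proj.hom_mult env_proj.hom_inv w x0 As.m_closed As.inv_closed)
  then have "env_gen x [^]\<^bsub>env\<^esub> left_order
      = env_proj w \<otimes>\<^bsub>env\<^esub> env_gen x0 [^]\<^bsub>env\<^esub> left_order \<otimes>\<^bsub>env\<^esub> inv\<^bsub>env\<^esub> env_proj w"
    by (simp only: env.conjugate_pow v env_gen_closed base_point)
  also have "\<dots> = \<one>\<^bsub>env\<^esub>"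
    by (simp only: x0_power env.r_one env.r_inv v)
  finally show ?thesis .
qed

text \<open>The enveloping group is generated by the generators as a monoid, because the inverse of a generator
  is a power of it with exponent in the natural numbers.  This matters for invariant subspaces: on an infinite-dimensional space, a subspace
  mapped into itself by an automorphism need not be mapped into itself by the inverse.\<close>

lemma env_induct [consumes 1, case_names one gen]:
  assumes g: "g \<in> carrier env"
    and one: "P \<one>\<^bsub>env\<^esub>"
    and gen: "\<And>x h. \<lbrakk>x \<in> carrier X; h \<in> carrier env; P h\<rbrakk> \<Longrightarrow> P (env_gen x \<otimes>\<^bsub>env\<^esub> h)"
  shows "P g"
proof -
  have pow: "P (env_gen x [^]\<^bsub>env\<^esub> k \<otimes>\<^bsub>env\<^esub> h)"
    if "x \<in> carrier X" "h \<in> carrier env" "P h" for x h and k :: nat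
  proof (induction k)
    case (Suc k)
    let ?p = "env_gen x [^]\<^bsub>env\<^esub> k"
    have x: "env_gen x \<in> carrier env" and p: "?p \<in> carrier env" using that by simp_all
    have eq: "env_gen x [^]\<^bsub>env\<^esub> Suc k \<otimes>\<^bsub>env\<^esub> h = env_gen x \<otimes>\<^bsub>env\<^esub> (?p \<otimes>\<^bsub>env\<^esub> h)"
      using env.nat_pow_Suc2[OF x, of k] env.m_assoc[OF x p that(2)] by (rule ssubst)
    show ?case
      unfolding eq by (rule gen[OF that(1) env.m_closed[OF p that(2)] Suc])
  qed (use that in simp)
  have inv_eq_power: "inv\<^bsub>env\<^esub> env_gen x = env_gen x [^]\<^bsub>env\<^esub> (left_order - 1)"
    if x: "x \<in> carrier X" for x
    using env_gen_power[OF x] left_order_pos x env.nat_pow_Suc[of "env_gen x" "left_order - 1"]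
    by (intro env.inv_equality) auto
  obtain w where "w \<in> carrier (As X)" and g_w: "g = env_proj w"
    using g by (rule env_cases)
  from this(1) have "P (env_proj w)"
  proof (induction rule: As_induct)
    case one
    then show ?case using assms(2) by (simp only: env_proj.hom_one)
  next
    case (gen x v)
    then show ?case
      using assms(3)[of x "env_proj v"] env_proj.hom_closed[of v] by (simp add: env_gen_def)
  next
    case (inv_gen x v)
    then show ?case
      using pow[of x "env_proj v" "left_order - 1"] env_proj.hom_closed[of v]
        inv_eq_power[of x]
      by (simp add: env_gen_def)
  qed
  then show ?thesis using g_w by simp
qed

lemma stabilizing_family_env_central:
  assumes us: "stabilizing_family X us"
  shows "family_prod env env_gen us \<in> group_center env"
proof -
  let ?w = "family_prod (As X) (As_gen X) us"
  have usc: "set us \<subseteq> carrier X" using us by (auto simp: stabilizing_family_def)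
  have eq: "family_prod env env_gen us = env_proj ?w"
    using usc by (subst env_proj.hom_family_prod) (auto simp: env_gen_def[abs_def])
  have w: "?w \<in> group_center (As X)" by (rule stabilizing_family_central[OF us])
  have wc: "?w \<in> carrier (As X)" using w by (simp add: group_center_def)
  have "env_proj ?w \<otimes>\<^bsub>env\<^esub> g = g \<otimes>\<^bsub>env\<^esub> env_proj ?w" if g: "g \<in> carrier env" for g
  proof -
    obtain v where v: "v \<in> carrier (As X)" "g = env_proj v"
      using g by (rule env_cases)
    then show ?thesis
      using w wc by (simp add: group_center_def flip: env_proj.hom_mult)
  qed
  then show ?thesis using eq env_proj.hom_closed[OF wc] by (simp add: group_center_def)
qed

section \<open>Strong representations and representations of the enveloping group\<close>

definition rep_pullback :: "(('x \<times> bool) list set set, 'v) rep \<Rightarrow> ('x, 'v) rep" where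
  "rep_pullback = (\<lambda>(V, \<phi>). (V, \<lambda>x. \<phi> (env_gen x)))"

lemma invariant_subspace_iff:
  assumes rep: "group_rep env (V, \<phi>)" and W: "W \<subseteq> carrier V"
  shows "(\<forall>x\<in>carrier X. \<phi> (env_gen x) ` W \<subseteq> W) \<longleftrightarrow> (\<forall>g\<in>carrier env. \<phi> g ` W \<subseteq> W)"
proof (intro iffI ballI)
  fix g assume X: "\<forall>x\<in>carrier X. \<phi> (env_gen x) ` W \<subseteq> W" and g: "g \<in> carrier env"
  show "\<phi> g ` W \<subseteq> W"
    using g
  proof (induction rule: env_induct)
    case one
    then show ?case using W env.group_rep_apply(2)[OF rep] by auto
  next
    case (gen x h)
    have "\<phi> (env_gen x \<otimes>\<^bsub>env\<^esub> h) v \<in> W" if v: "v \<in> W" for v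
      using env.group_rep_apply(3)[OF rep, of "env_gen x" h v] gen X W v by force
    then show ?case by auto
  qed
qed auto

lemma irreducible_pullback_iff:
  assumes "group_rep env (V, \<phi>)"
  shows "irreducible_rep (carrier X) (rep_pullback (V, \<phi>)) \<longleftrightarrow> irreducible_rep (carrier env) (V, \<phi>)"
proof -
  have sub: "W \<subseteq> carrier V" if "VectorSpace.subspace class_ring W V" for W
    using that by (auto simp: VectorSpace.subspace_def submodule_def)
  have "VectorSpace.subspace class_ring W V \<and> (\<forall>x\<in>carrier X. \<phi> (env_gen x) ` W \<subseteq> W)
      \<longleftrightarrow> VectorSpace.subspace class_ring W V \<and> (\<forall>g\<in>carrier env. \<phi> g ` W \<subseteq> W)" for W
    using invariant_subspace_iff[OF assms, of W] sub[of W] by blast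
  then show ?thesis by (simp add: irreducible_rep_def rep_pullback_def)
qed

lemma equivalent_pullback_iff:
  assumes rep: "group_rep env (V, \<phi>)" and rep': "group_rep env (V', \<phi>')"
  shows "equivalent_reps (carrier X) (rep_pullback (V, \<phi>)) (rep_pullback (V', \<phi>'))
    \<longleftrightarrow> equivalent_reps (carrier env) (V, \<phi>) (V', \<phi>')"
proof -
  have "(\<forall>x\<in>carrier X. \<forall>v\<in>carrier V. \<phi>' (env_gen x) (T v) = T (\<phi> (env_gen x) v))
    \<longleftrightarrow> (\<forall>g\<in>carrier env. \<forall>v\<in>carrier V. \<phi>' g (T v) = T (\<phi> g v))" (is "?L \<longleftrightarrow> ?R")
    if T: "bij_betw T (carrier V) (carrier V')" for T
  proof
    have TV: "T v \<in> carrier V'" if "v \<in> carrier V" for v using T that by (auto simp: bij_betw_def)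
    assume X: ?L
    show ?R
    proof
      fix g assume "g \<in> carrier env"
      then show "\<forall>v\<in>carrier V. \<phi>' g (T v) = T (\<phi> g v)"
      proof (induction rule: env_induct)
        case one
        then show ?case using TV env.group_rep_apply(2)[OF rep] env.group_rep_apply(2)[OF rep'] by simp
      next
        case (gen x h)
        then show ?case
          using X TV env.group_rep_apply[OF rep] env.group_rep_apply[OF rep'] by simp
      qed
    qed
  qed simp
  then show ?thesis
    unfolding equivalent_reps_def rep_pullback_def prod.case
    by (intro ex_cong1 conj_cong HOL.refl)
qed

text \<open>A stabilizing family maps to a central element of the enveloping group, which is trivial by hypothesis.\<close>

lemma strong_pullback:
  assumes center: "group_center env = {\<one>\<^bsub>env\<^esub>}" and rep: "group_rep env (V, \<phi>)"
  shows "strong_rep X (rep_pullback (V, \<phi>))"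
proof -
  have V: "vectorspace class_ring V" and \<phi>: "\<phi> \<in> hom env (GL V)"
    using rep by (auto simp: group_rep_def)
  interpret gh: group_hom env "GL V" \<phi>
    using \<phi> group_GL[OF V] by (simp add: group_hom_def group_hom_axioms_def env.group_axioms)
  have "(\<lambda>x. \<phi> (env_gen x)) \<in> rack_hom X (Conj (GL V))"
    using env_gen_rack_hom by (auto simp: rack_hom_def Conj_def)
  moreover have "family_prod (GL V) (\<lambda>x. \<phi> (env_gen x)) us = \<one>\<^bsub>GL V\<^esub>"
    if us: "stabilizing_family X us" for us
  proof -
    have "family_prod env env_gen us = \<one>\<^bsub>env\<^esub>" using stabilizing_family_env_central[OF us] center by simp
    moreover have "env_gen ` set us \<subseteq> carrier env"
      using us by (auto simp: stabilizing_family_def)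
    ultimately show ?thesis using gh.hom_family_prod[of env_gen us] by simp
  qed
  ultimately show ?thesis using V by (simp add: strong_rep_def rack_rep_def rep_pullback_def)
qed

text \<open>The extension to the associated group exists by its universal property.  It factors through the
  quotient because strongness, applied to the family \<open>x0\<close>, \<open>\<dots>\<close>, \<open>x0\<close>, kills the power that generates the
  normal subgroup.\<close>

lemma strong_rep_extends:
  assumes "strong_rep X (V, \<rho>)"
  obtains \<phi> where "group_rep env (V, \<phi>)" "\<And>x. x \<in> carrier X \<Longrightarrow> \<phi> (env_gen x) = \<rho> x"
proof -
  have V: "vectorspace class_ring V" and \<rho>: "\<rho> \<in> rack_hom X (Conj (GL V))"
    and strong: "\<And>us. stabilizing_family X us \<Longrightarrow> family_prod (GL V) \<rho> us = \<one>\<^bsub>GL V\<^esub>"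
    using assms by (auto simp: strong_rep_def rack_rep_def)
  interpret GL: group "GL V" by (rule group_GL[OF V])
  obtain h where h: "h \<in> hom (As X) (GL V)" "\<And>x. x \<in> carrier X \<Longrightarrow> h (As_gen X x) = \<rho> x"
    using As_universal[OF GL.group_axioms \<rho>] by blast
  interpret h: group_hom "As X" "GL V" h
    using h(1) by (simp add: group_hom_def group_hom_axioms_def GL.group_axioms As.group_axioms)
  have \<rho>0: "\<rho> x0 \<in> carrier (GL V)" using \<rho> base_point by (auto simp: rack_hom_def Conj_def)
  have "h (As_gen X x0 [^]\<^bsub>As X\<^esub> left_order) = \<one>\<^bsub>GL V\<^esub>"
    using strong[OF stabilizing_family_left_order] base_point \<rho>0
    by (simp add: h.hom_nat_pow h(2) GL.family_prod_replicate)
  then have "power_subgroup \<subseteq> kernel (As X) (GL V) h"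
    using base_point by (intro As.generate_subgroup_incl h.subgroup_kernel) (auto simp: kernel_def)
  then obtain \<phi> where "\<phi> \<in> hom env (GL V)" "\<And>w. w \<in> carrier (As X) \<Longrightarrow> \<phi> (env_proj w) = h w"
    using h.FactGroup_universal_kernel[OF power_subgroup_normal] unfolding env_def by metis
  then show thesis
    using V h(2) by (intro that[of \<phi>]) (auto simp: group_rep_def env_gen_def)
qed

end

theorem corollary6p3:
  fixes X :: "'x rack" and x0 :: 'x
  assumes "rack X" and "finite (carrier X)" and "connected_rack X"
    and "x0 \<in> carrier X"
    and "group_center (finite_enveloping_group X x0) = {\<one>\<^bsub>finite_enveloping_group X x0\<^esub>}"
  shows "up_to_equivalence (carrier X) (irreducible_strong_reps X :: ('x, 'v) rep set)
    \<approx> up_to_equivalence (carrier (finite_enveloping_group X x0))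
        (irreducible_group_reps (finite_enveloping_group X x0)
           :: (('x \<times> bool) list set set, 'v) rep set)"
proof -
  interpret pointed_finite_connected_rack X x0
    using assms(1-4)
    by (simp add: pointed_finite_connected_rack_def pointed_finite_connected_rack_axioms_def)
  show ?thesis
    unfolding up_to_equivalence_def
  proof (rule quotient_eqpoll_via[where f = rep_pullback])
    show "rep_pullback ` irreducible_group_reps env \<subseteq> irreducible_strong_reps X"
      by (auto simp: irreducible_group_reps_def irreducible_strong_reps_def
          strong_pullback[OF assms(5)] irreducible_pullback_iff simp del: split_paired_All)
  next
    fix p q :: "(('x \<times> bool) list set set, 'v) rep"
    assume "p \<in> irreducible_group_reps env" "q \<in> irreducible_group_reps env"
    then show "equivalent_reps (carrier X) (rep_pullback p) (rep_pullback q)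
        \<longleftrightarrow> equivalent_reps (carrier env) p q"
      using equivalent_pullback_iff by (cases p; cases q) (auto simp: irreducible_group_reps_def)
  next
    fix a :: "('x, 'v) rep" assume a: "a \<in> irreducible_strong_reps X"
    obtain V \<rho> where a_eq: "a = (V, \<rho>)" by force
    obtain \<phi> where rep: "group_rep env (V, \<phi>)"
      and \<phi>: "\<And>x. x \<in> carrier X \<Longrightarrow> \<phi> (env_gen x) = \<rho> x"
      using a strong_rep_extends[of V \<rho>] by (auto simp: a_eq irreducible_strong_reps_def)
    have "irreducible_rep (carrier X) (rep_pullback (V, \<phi>))"
      using a irreducible_rep_cong[of "carrier X" "\<lambda>x. \<phi> (env_gen x)" \<rho> V] \<phi>
      by (simp add: a_eq irreducible_strong_reps_def rep_pullback_def)
    then have "(V, \<phi>) \<in> irreducible_group_reps env"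
      using irreducible_pullback_iff[OF rep] rep by (simp add: irreducible_group_reps_def)
    then show "\<exists>b\<in>irreducible_group_reps env. \<forall>c.
        (equivalent_reps (carrier X) (rep_pullback b) c \<longleftrightarrow> equivalent_reps (carrier X) a c) \<and>
        (equivalent_reps (carrier X) c (rep_pullback b) \<longleftrightarrow> equivalent_reps (carrier X) c a)"
      using equivalent_reps_cong[of "carrier X" "\<lambda>x. \<phi> (env_gen x)" \<rho>] \<phi>
      by (intro bexI[of _ "(V, \<phi>)"]) (simp_all add: a_eq rep_pullback_def)
  qed
qed

end
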